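(* Let $\alpha,\beta,\gamma\in\{\frac{\pi}{4},\frac{3\pi}{4},\frac{5\pi}{4},\frac{7\pi}{4}\}$, let $\mu_1=\pi/2$ if $\alpha+\gamma\in\{k\pi: k\in\mathbb{N}\}$ and $\mu_1=3\pi/2$ otherwise, and let $\nu_1=0$ if $\alpha+\beta\in\{k\pi: k\in\mathbb{N}\}$ and $\nu_1=\pi$ otherwise. Let $$U=\bigl(R_y(\nu_1)R_z(\mu_1)\otimes\mathbb{1}_2\bigr)\,C_{21}\,(\mathbb{1}_2\otimes R_y(\beta))\,C_{12}\,(R_z(\gamma)\otimes R_y(\alpha))\,C_{21}.$$ Then $U$ achieves perfect quantum-phase synchronization for equatorial initial product states: for every $\rho=\rho_1\otimes\rho_2$, where $\rho_i$ is the qubit state with Bloch vector $r_i(\cos\varphi_i,\sin\varphi_i,0)$, $r_i\in[0,1]$, $\varphi_i\in[0,2\pi]$, $i=1,2$, one has $F(\rho,U)=1$ whenever $F(\rho,U)$ is defined. In particular this holds for $U_{\mathrm{max}}$, the unitary $U$ with $\alpha=\frac{3\pi}{4}$, $\beta=\gamma=\frac{\pi}{4}$, $\mu_1=\frac{\pi}{2}$, $\nu_1=0$.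
   Context: $C_{ij}$ is the CNOT gate with qubit $i$ as control and qubit $j$ as target; $R_y(\alpha)=e^{-i\alpha\sigma_y/2}$, $R_z(\alpha)=e^{-i\alpha\sigma_z/2}$; in a tensor product the first factor acts on qubit 1, the second on qubit 2. The Bloch vector of a qubit density matrix $\rho$ is $\mathbf n=\operatorname{tr}(\boldsymbol\sigma\rho)=(n_x,n_y,n_z)$, with $\boldsymbol\sigma$ the vector of Pauli matrices, so $\rho=(\mathbb{1}+\mathbf n\cdot\boldsymbol\sigma)/2$; let $\mathbf m=(n_x,n_y)$. The quantum-phase fidelity of two qubit states with $\mathbf m_1\neq0$ and $\mathbf m_2\ne0$ is $f(\rho_1,\rho_2)=\dfrac{\mathbf m_1\cdot\mathbf m_2}{\|\mathbf m_1\|\,\|\mathbf m_2\|}$; otherwise it is undefined. For a two-qubit state $\rho$ and a unitary $U$, let $\rho'=U\rho U^\dagger$, $\rho_1'=\operatorname{tr}_2\rho'$, $\rho_2'=\operatorname{tr}_1\rho'$; the phase synchronization fidelity is $F(\rho,U)=f(\rho_1',\rho_2')$, undefined when $f(\rho_1',\rho_2')$ is undefined. *)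

theory Defs
  imports "HOL-Analysis.Analysis"
begin

text \<open>
  Index \<open>1 :: 2\<close> is the basis state \<open>|0>\<close>, index \<open>2 :: 2\<close> is \<open>|1>\<close>. Two-qubit operators are
  indexed by pairs whose first component belongs to qubit 1 and second component to qubit 2.
\<close>

type_synonym qubit_op = "complex ^ 2 ^ 2"
type_synonym two_qubit_op = "complex ^ (2 \<times> 2) ^ (2 \<times> 2)"

definition dagger :: "complex ^ 'n ^ 'm \<Rightarrow> complex ^ 'm ^ 'n" where
  "dagger A = map_matrix cnj (transpose A)"

primrec mat_pow :: "complex ^ 'n ^ 'n \<Rightarrow> nat \<Rightarrow> complex ^ 'n ^ 'n" where
  "mat_pow A 0 = mat 1"
| "mat_pow A (Suc k) = A ** mat_pow A k"

text \<open>
  The library's \<open>exp\<close> is not available at matrix types, since \<open>**\<close> is not a type-class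
  multiplication; this is the exponential series for \<open>**\<close>.
\<close>
definition mat_exp :: "complex ^ 'n ^ 'n \<Rightarrow> complex ^ 'n ^ 'n" where
  "mat_exp A = (\<Sum>k. (1 / fact k) *\<^sub>R mat_pow A k)"

definition sigma_x :: qubit_op where
  "sigma_x = vector [vector [0, 1], vector [1, 0]]"

definition sigma_y :: qubit_op where
  "sigma_y = vector [vector [0, - \<i>], vector [\<i>, 0]]"

definition sigma_z :: qubit_op where
  "sigma_z = vector [vector [1, 0], vector [0, - 1]]"

definition R_y :: "real \<Rightarrow> qubit_op" where
  "R_y \<alpha> = mat_exp (map_matrix ((*) (- \<i> * complex_of_real \<alpha> / 2)) sigma_y)"

definition R_z :: "real \<Rightarrow> qubit_op" where
  "R_z \<alpha> = mat_exp (map_matrix ((*) (- \<i> * complex_of_real \<alpha> / 2)) sigma_z)"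

definition tensor_op :: "qubit_op \<Rightarrow> qubit_op \<Rightarrow> two_qubit_op" (infixr "\<otimes>\<^sub>q" 75) where
  "A \<otimes>\<^sub>q B = (\<chi> p q. A $ fst p $ fst q * B $ snd p $ snd q)"

definition proj_0 :: qubit_op where
  "proj_0 = vector [vector [1, 0], vector [0, 0]]"

definition proj_1 :: qubit_op where
  "proj_1 = vector [vector [0, 0], vector [0, 1]]"

definition C12 :: two_qubit_op where
  "C12 = (proj_0 \<otimes>\<^sub>q mat 1) + (proj_1 \<otimes>\<^sub>q sigma_x)"

definition C21 :: two_qubit_op where
  "C21 = (mat 1 \<otimes>\<^sub>q proj_0) + (sigma_x \<otimes>\<^sub>q proj_1)"

text \<open>\<open>tr_2\<close> traces out qubit 2 and \<open>tr_1\<close> traces out qubit 1.\<close>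

definition tr_2 :: "two_qubit_op \<Rightarrow> qubit_op" where
  "tr_2 \<rho> = (\<chi> i j. \<Sum>k\<in>UNIV. \<rho> $ (i, k) $ (j, k))"

definition tr_1 :: "two_qubit_op \<Rightarrow> qubit_op" where
  "tr_1 \<rho> = (\<chi> i j. \<Sum>k\<in>UNIV. \<rho> $ (k, i) $ (k, j))"

definition density_matrix :: "complex ^ 'n ^ 'n \<Rightarrow> bool" where
  "density_matrix \<rho> \<longleftrightarrow> dagger \<rho> = \<rho> \<and> trace \<rho> = 1 \<and>
     (\<forall>v. 0 \<le> Re (\<Sum>i\<in>UNIV. cnj (v $ i) * (\<rho> *v v) $ i))"

text \<open>The traces below are real for Hermitian \<open>\<rho>\<close>; \<open>Re\<close> only changes the type.\<close>
definition bloch_vector :: "qubit_op \<Rightarrow> real ^ 3" where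
  "bloch_vector \<rho> =
     vector [Re (trace (sigma_x ** \<rho>)), Re (trace (sigma_y ** \<rho>)), Re (trace (sigma_z ** \<rho>))]"

definition bloch_xy :: "qubit_op \<Rightarrow> real ^ 2" where
  "bloch_xy \<rho> = vector [bloch_vector \<rho> $ 1, bloch_vector \<rho> $ 2]"

text \<open>\<open>None\<close> means undefined.\<close>
definition quantum_phase_fidelity :: "qubit_op \<Rightarrow> qubit_op \<Rightarrow> real option" where
  "quantum_phase_fidelity \<rho>1 \<rho>2 =
     (if bloch_xy \<rho>1 \<noteq> 0 \<and> bloch_xy \<rho>2 \<noteq> 0
      then Some ((bloch_xy \<rho>1 \<bullet> bloch_xy \<rho>2) / (norm (bloch_xy \<rho>1) * norm (bloch_xy \<rho>2)))
      else None)"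

definition phase_sync_fidelity :: "two_qubit_op \<Rightarrow> two_qubit_op \<Rightarrow> real option" where
  "phase_sync_fidelity \<rho> U =
     (let \<rho>' = U ** \<rho> ** dagger U in quantum_phase_fidelity (tr_2 \<rho>') (tr_1 \<rho>'))"

definition equatorial_state :: "qubit_op \<Rightarrow> bool" where
  "equatorial_state \<rho> \<longleftrightarrow> density_matrix \<rho> \<and>
     (\<exists>r\<in>{0..1}. \<exists>\<phi>\<in>{0..2 * pi}. bloch_vector \<rho> = vector [r * cos \<phi>, r * sin \<phi>, 0])"

definition perfect_sync_equatorial :: "two_qubit_op \<Rightarrow> bool" where
  "perfect_sync_equatorial U \<longleftrightarrow>
     (\<forall>\<rho>1 \<rho>2. equatorial_state \<rho>1 \<longrightarrow> equatorial_state \<rho>2 \<longrightarrow>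
        phase_sync_fidelity (\<rho>1 \<otimes>\<^sub>q \<rho>2) U \<noteq> None \<longrightarrow>
        phase_sync_fidelity (\<rho>1 \<otimes>\<^sub>q \<rho>2) U = Some 1)"

definition sync_unitary :: "real \<Rightarrow> real \<Rightarrow> real \<Rightarrow> real \<Rightarrow> real \<Rightarrow> two_qubit_op" where
  "sync_unitary \<alpha> \<beta> \<gamma> \<mu> \<nu> =
     ((R_y \<nu> ** R_z \<mu>) \<otimes>\<^sub>q mat 1) ** C21 ** (mat 1 \<otimes>\<^sub>q R_y \<beta>) ** C12
       ** (R_z \<gamma> \<otimes>\<^sub>q R_y \<alpha>) ** C21"

definition U_max :: two_qubit_op where
  "U_max = sync_unitary (3 * pi / 4) (pi / 4) (pi / 4) (pi / 2) 0"

end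

theory Submission
  imports Defs
begin

text \<open>
  Expand the state in the basis of tensor products of Pauli matrices. Every gate acts linearly on
  the real coefficients: single-qubit rotations rotate the Bloch components of one qubit, and
  CNOTs permute the basis up to sign. Following the coefficients of an equatorial product state
  through the circuit shows that the \<open>xy\<close>-parts of the two final Bloch vectors are not only
  parallel but equal, for any angles with \<open>cos \<mu> = 0\<close>, \<open>sin \<nu> = 0\<close>,
  \<open>cos (\<alpha> - sin \<mu> * \<gamma>) = 0\<close> and \<open>sin (\<alpha> + cos \<nu> * \<beta>) = 0\<close> such that
  \<open>cos \<alpha> \<noteq> 0\<close>.
\<close>

section \<open>Closed forms of the rotation gates\<close>

text \<open>Powers of \<open>S\<close> alternate between \<open>mat 1\<close> and \<open>S\<close>.
  The combinations of \<open>c ^ k\<close> and \<open>(- c) ^ k\<close> select the parity of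
  \<open>k\<close> without a case split.\<close>

lemma mat_pow_scaled_involution:
  fixes S :: "complex ^ 'n ^ 'n"
  assumes "S ** S = mat 1"
  shows "mat_pow (map_matrix ((*) c) S) k =
    map_matrix ((*) ((c ^ k + (- c) ^ k) / 2)) (mat 1) + map_matrix ((*) ((c ^ k - (- c) ^ k) / 2)) S"
proof (induction k)
  case 0
  then show ?case by (simp add: vec_eq_iff map_matrix_def)
next
  case (Suc k)
  have *: "map_matrix ((*) a) A ** map_matrix ((*) b) B = map_matrix ((*) (a * b)) (A ** B)"
    for a b and A B :: "complex ^ 'n ^ 'n"
    by (simp add: vec_eq_iff map_matrix_def matrix_matrix_mult_def sum_distrib_left algebra_simps)
  have "mat_pow (map_matrix ((*) c) S) (Suc k) =
     map_matrix ((*) (c * ((c ^ k + (- c) ^ k) / 2))) S + map_matrix ((*) (c * ((c ^ k - (- c) ^ k) / 2))) (mat 1)"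
    unfolding mat_pow.simps Suc matrix_add_ldistrib * assms by simp
  then show ?case
    by (simp add: vec_eq_iff map_matrix_def add_divide_distrib diff_divide_distrib algebra_simps)
qed

lemma mat_exp_scaled_involution:
  fixes S :: "complex ^ 'n ^ 'n"
  assumes "S ** S = mat 1"
  shows "mat_exp (map_matrix ((*) c) S) = map_matrix ((*) (cosh c)) (mat 1) + map_matrix ((*) (sinh c)) S"
proof -
  let ?f = "\<lambda>k. (1 / fact k) *\<^sub>R mat_pow (map_matrix ((*) c) S) k"
  let ?s = "map_matrix ((*) (cosh c)) (mat 1) + map_matrix ((*) (sinh c)) S"
  have "(\<lambda>k. ?f k $ i $ j) sums (?s $ i $ j)" for i j
  proof -
    \<comment> \<open>Each entry combines the exponential series of \<open>c\<close> and
      \<open>- c\<close>, whose half sum and half difference are \<open>cosh c\<close> and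
      \<open>sinh c\<close>.\<close>
    have "(\<lambda>k. ((c ^ k /\<^sub>R fact k + (- c) ^ k /\<^sub>R fact k) / 2) * mat 1 $ i $ j
        + ((c ^ k /\<^sub>R fact k - (- c) ^ k /\<^sub>R fact k) / 2) * S $ i $ j)
       sums (((exp c + exp (- c)) / 2) * mat 1 $ i $ j + ((exp c - exp (- c)) / 2) * S $ i $ j)"
      by (intro sums_add sums_mult2 sums_divide sums_diff exp_converges)
    moreover have "?f k $ i $ j = ((c ^ k /\<^sub>R fact k + (- c) ^ k /\<^sub>R fact k) / 2) * mat 1 $ i $ j
        + ((c ^ k /\<^sub>R fact k - (- c) ^ k /\<^sub>R fact k) / 2) * S $ i $ j" for k
      unfolding mat_pow_scaled_involution[OF assms]
      by (simp add: map_matrix_def scaleR_conv_of_real[where 'a = complex] field_simps)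
    moreover have "?s $ i $ j = ((exp c + exp (- c)) / 2) * mat 1 $ i $ j + ((exp c - exp (- c)) / 2) * S $ i $ j"
      by (simp add: map_matrix_def cosh_def sinh_def scaleR_conv_of_real)
    ultimately show ?thesis by simp
  qed
  then have "?f sums ?s"
    unfolding sums_def by (intro vec_tendstoI) (simp add: sum_component)
  then show ?thesis
    unfolding mat_exp_def by (simp add: sums_iff)
qed

lemma cosh_sinh_i_times:
  "cosh (- \<i> * complex_of_real \<alpha> / 2) = cos (\<alpha> / 2)"
  "sinh (- \<i> * complex_of_real \<alpha> / 2) = - \<i> * sin (\<alpha> / 2)"
proof -
  have "exp (- \<i> * complex_of_real \<alpha> / 2) = cis (- \<alpha> / 2)"
    "exp (- (- \<i> * complex_of_real \<alpha> / 2)) = cis (\<alpha> / 2)"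
    by (simp_all add: cis_conv_exp)
  then show "cosh (- \<i> * complex_of_real \<alpha> / 2) = cos (\<alpha> / 2)"
    "sinh (- \<i> * complex_of_real \<alpha> / 2) = - \<i> * sin (\<alpha> / 2)"
    unfolding cosh_def sinh_def by (simp_all add: complex_eq_iff)
qed

lemma R_y_eq:
  "R_y \<alpha> = vector [vector [complex_of_real (cos (\<alpha>/2)), - complex_of_real (sin (\<alpha>/2))],
                    vector [complex_of_real (sin (\<alpha>/2)), complex_of_real (cos (\<alpha>/2))]]"
proof -
  have "sigma_y ** sigma_y = mat 1"
    by (simp add: sigma_y_def vec_eq_iff matrix_matrix_mult_def mat_def forall_2 sum_2)
  then show ?thesis
    unfolding R_y_def
    by (simp only: mat_exp_scaled_involution cosh_sinh_i_times)
       (simp add: sigma_y_def vec_eq_iff map_matrix_def mat_def forall_2 complex_eq_iff)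
qed

lemma R_z_eq:
  "R_z \<alpha> = vector [vector [cis (- \<alpha> / 2), 0], vector [0, cis (\<alpha> / 2)]]"
proof -
  have "sigma_z ** sigma_z = mat 1"
    by (simp add: sigma_z_def vec_eq_iff matrix_matrix_mult_def mat_def forall_2 sum_2)
  then show ?thesis
    unfolding R_z_def
    by (simp only: mat_exp_scaled_involution cosh_sinh_i_times)
       (simp add: sigma_z_def vec_eq_iff map_matrix_def mat_def forall_2 complex_eq_iff)
qed

section \<open>Conjugation by gates and tensor products\<close>

text \<open>The state \<open>\<rho>'\<close> of \<open>phase_sync_fidelity\<close>, named so that a
  circuit can be followed gate by gate.\<close>

definition conj_op :: "complex ^ 'n ^ 'n \<Rightarrow> complex ^ 'n ^ 'n \<Rightarrow> complex ^ 'n ^ 'n" where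
  "conj_op U X = U ** X ** dagger U"

lemma dagger_mult: "dagger (A ** B) = dagger B ** dagger A"
  by (simp add: dagger_def vec_eq_iff map_matrix_def transpose_def matrix_matrix_mult_def mult.commute)

lemma conj_op_mult: "conj_op (A ** B) X = conj_op A (conj_op B X)"
  by (simp add: conj_op_def dagger_mult matrix_mul_assoc)

lemma conj_op_sum: "conj_op U (\<Sum>i\<in>I. X i) = (\<Sum>i\<in>I. conj_op U (X i))"
proof -
  have add: "conj_op U (X + Y) = conj_op U X + conj_op U Y" for X Y
    by (simp add: conj_op_def vec_eq_iff matrix_matrix_mult_def sum.distrib distrib_left distrib_right)
  have "conj_op U 0 = 0"
    using add[of 0 0] by simp
  then show ?thesis
    by (induction I rule: infinite_finite_induct) (simp_all add: add)
qed

lemma tensor_op_mult: "(A \<otimes>\<^sub>q B) ** (C \<otimes>\<^sub>q D) = (A ** C) \<otimes>\<^sub>q (B ** D)"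
  by (simp add: tensor_op_def vec_eq_iff matrix_matrix_mult_def sum_product sum.cartesian_product
      split_beta mult_ac flip: UNIV_Times_UNIV)

lemma dagger_tensor_op: "dagger (A \<otimes>\<^sub>q B) = dagger A \<otimes>\<^sub>q dagger B"
  by (simp add: tensor_op_def vec_eq_iff dagger_def map_matrix_def transpose_def)

lemma conj_op_tensor: "conj_op (A \<otimes>\<^sub>q B) (X \<otimes>\<^sub>q Y) = conj_op A X \<otimes>\<^sub>q conj_op B Y"
  by (simp add: conj_op_def dagger_tensor_op tensor_op_mult)

lemma conj_op_mat_1:
  fixes X :: "complex ^ 'n ^ 'n"
  shows "conj_op (mat 1) X = X"
proof -
  have "dagger (mat 1 :: complex ^ 'n ^ 'n) = mat 1"
    by (simp add: vec_eq_iff dagger_def map_matrix_def transpose_def mat_def)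
  then show ?thesis by (simp add: conj_op_def)
qed

section \<open>Pauli expansions and the action of the gates on their coefficients\<close>

definition pauli :: "nat \<Rightarrow> qubit_op" where
  "pauli i = [mat 1, sigma_x, sigma_y, sigma_z] ! i"

text \<open>No factor 1/2 is built in: a qubit state has \<open>v 0 = 1/2\<close>, and its other
  coefficients are half the Bloch components.\<close>

definition pauli_sum :: "(nat \<Rightarrow> real) \<Rightarrow> qubit_op" where
  "pauli_sum v = (\<Sum>i<4. v i *\<^sub>R pauli i)"

definition pauli_sum2 :: "(nat \<Rightarrow> nat \<Rightarrow> real) \<Rightarrow> two_qubit_op" where
  "pauli_sum2 t = (\<Sum>i<4. \<Sum>j<4. t i j *\<^sub>R (pauli i \<otimes>\<^sub>q pauli j))"

lemma pauli_sum_eq: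
  "pauli_sum v = vector [vector [Complex (v 0 + v 3) 0, Complex (v 1) (- v 2)],
                         vector [Complex (v 1) (v 2), Complex (v 0 - v 3) 0]]"
  by (simp add: pauli_sum_def pauli_def sigma_x_def sigma_y_def sigma_z_def vec_eq_iff mat_def
      forall_2 eval_nat_numeral complex_eq_iff)

text \<open>Rotation by \<alpha> about the y axis of the Bloch ball, with coefficient 0 fixed as
  well.\<close>

definition rot_y :: "real \<Rightarrow> (nat \<Rightarrow> real) \<Rightarrow> nat \<Rightarrow> real" where
  "rot_y \<alpha> v = v(1 := cos \<alpha> * v 1 + sin \<alpha> * v 3, 3 := cos \<alpha> * v 3 - sin \<alpha> * v 1)"

definition rot_z :: "real \<Rightarrow> (nat \<Rightarrow> real) \<Rightarrow> nat \<Rightarrow> real" where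
  "rot_z \<alpha> v = v(1 := cos \<alpha> * v 1 - sin \<alpha> * v 2, 2 := sin \<alpha> * v 1 + cos \<alpha> * v 2)"

text \<open>The passage from SU(2) to SO(3): conjugation is quadratic in the gate entries, so half
  angles become full angles.\<close>

lemma conj_op_R_y: "conj_op (R_y \<alpha>) (pauli_sum v) = pauli_sum (rot_y \<alpha> v)"
proof -
  \<comment> \<open>With the half-angle values named, the entries are polynomial identities modulo
    \<open>c\<^sup>2 + s\<^sup>2 = 1\<close>.\<close>
  define c s where "c = cos (\<alpha> / 2)" and "s = sin (\<alpha> / 2)"
  have half: "cos \<alpha> = c\<^sup>2 - s\<^sup>2" "sin \<alpha> = 2 * s * c" and one: "c\<^sup>2 + s\<^sup>2 = 1"
    using cos_double[of "\<alpha> / 2"] sin_double[of "\<alpha> / 2"] by (simp_all add: c_def s_def)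
  show ?thesis
    unfolding R_y_eq pauli_sum_eq conj_op_def rot_y_def half c_def[symmetric] s_def[symmetric]
    using one
    by (simp add: vec_eq_iff matrix_matrix_mult_def dagger_def map_matrix_def transpose_def
        forall_2 sum_2 complex_eq_iff,
        (intro conjI; (algebra | simp add: algebra_simps power2_eq_square)))
qed

lemma conj_op_R_z: "conj_op (R_z \<alpha>) (pauli_sum v) = pauli_sum (rot_z \<alpha> v)"
proof -
  define c s where "c = cos (\<alpha> / 2)" and "s = sin (\<alpha> / 2)"
  have half: "cos \<alpha> = c\<^sup>2 - s\<^sup>2" "sin \<alpha> = 2 * s * c" and one: "c\<^sup>2 + s\<^sup>2 = 1"
    using cos_double[of "\<alpha> / 2"] sin_double[of "\<alpha> / 2"] by (simp_all add: c_def s_def)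
  have cis: "cis (\<alpha> / 2) = Complex c s" "cis (- \<alpha> / 2) = Complex c (- s)"
    by (simp_all add: c_def s_def complex_eq_iff)
  show ?thesis
    unfolding R_z_eq pauli_sum_eq conj_op_def rot_z_def half cis
    using one
    by (simp add: vec_eq_iff matrix_matrix_mult_def dagger_def map_matrix_def transpose_def
        forall_2 sum_2 complex_eq_iff,
        (intro conjI; (algebra | simp add: algebra_simps power2_eq_square)))
qed

text \<open>Grouping by the Pauli matrix on qubit 2 exposes the operator on qubit 1, so a gate on
  qubit 1 acts on each column of the coefficient table separately.\<close>

lemma pauli_sum2_left: "pauli_sum2 t = (\<Sum>j<4. pauli_sum (\<lambda>i. t i j) \<otimes>\<^sub>q pauli j)"
  unfolding pauli_sum2_def pauli_sum_def
  by (subst sum.swap)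
     (simp add: tensor_op_def vec_eq_iff sum_distrib_right)

lemma pauli_sum2_right: "pauli_sum2 t = (\<Sum>i<4. pauli i \<otimes>\<^sub>q pauli_sum (t i))"
  unfolding pauli_sum2_def pauli_sum_def
  by (simp add: tensor_op_def vec_eq_iff sum_distrib_left)

lemma pauli_sum2_product: "pauli_sum u \<otimes>\<^sub>q pauli_sum v = pauli_sum2 (\<lambda>i j. u i * v j)"
  unfolding pauli_sum2_def pauli_sum_def
  by (simp add: tensor_op_def vec_eq_iff sum_product mult.commute[of "v _"])

lemma conj_op_left:
  assumes "\<And>v. conj_op A (pauli_sum v) = pauli_sum (f v)"
  shows "conj_op (A \<otimes>\<^sub>q mat 1) (pauli_sum2 t) = pauli_sum2 (\<lambda>i j. f (\<lambda>k. t k j) i)"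
  by (simp add: pauli_sum2_left conj_op_sum conj_op_tensor assms conj_op_mat_1)

lemma conj_op_right:
  assumes "\<And>v. conj_op A (pauli_sum v) = pauli_sum (f v)"
  shows "conj_op (mat 1 \<otimes>\<^sub>q A) (pauli_sum2 t) = pauli_sum2 (\<lambda>i. f (t i))"
  by (simp add: pauli_sum2_right conj_op_sum conj_op_tensor assms conj_op_mat_1)

lemma rot_y_simps:
  "rot_y \<alpha> v 0 = v 0" "rot_y \<alpha> v 1 = cos \<alpha> * v 1 + sin \<alpha> * v 3"
  "rot_y \<alpha> v 2 = v 2" "rot_y \<alpha> v 3 = cos \<alpha> * v 3 - sin \<alpha> * v 1"
  by (simp_all add: rot_y_def)

lemma rot_z_simps:
  "rot_z \<alpha> v 0 = v 0" "rot_z \<alpha> v 1 = cos \<alpha> * v 1 - sin \<alpha> * v 2"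
  "rot_z \<alpha> v 2 = sin \<alpha> * v 1 + cos \<alpha> * v 2" "rot_z \<alpha> v 3 = v 3"
  by (simp_all add: rot_z_def)

text \<open>Conjugation by the CNOT controlled by the second qubit; both indices run over \<open>1, X, Y, Z\<close>.\<close>
definition cnot_coeffs :: "(nat \<Rightarrow> nat \<Rightarrow> real) \<Rightarrow> nat \<Rightarrow> nat \<Rightarrow> real" where
  "cnot_coeffs t i j =
    [[t 0 0, t 1 1, t 1 2, t 0 3],
     [t 1 0, t 0 1, t 0 2, t 1 3],
     [t 2 3, t 3 2, - t 3 1, t 2 0],
     [t 3 3, - t 2 2, t 2 1, t 3 0]] ! i ! j"

lemma cnot_coeffs_simps:
  "cnot_coeffs t 0 0 = t 0 0" "cnot_coeffs t 0 1 = t 1 1" "cnot_coeffs t 0 2 = t 1 2" "cnot_coeffs t 0 3 = t 0 3"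
  "cnot_coeffs t 1 0 = t 1 0" "cnot_coeffs t 1 1 = t 0 1" "cnot_coeffs t 1 2 = t 0 2" "cnot_coeffs t 1 3 = t 1 3"
  "cnot_coeffs t 2 0 = t 2 3" "cnot_coeffs t 2 1 = t 3 2" "cnot_coeffs t 2 2 = - t 3 1" "cnot_coeffs t 2 3 = t 2 0"
  "cnot_coeffs t 3 0 = t 3 3" "cnot_coeffs t 3 1 = - t 2 2" "cnot_coeffs t 3 2 = t 2 1" "cnot_coeffs t 3 3 = t 3 0"
  by (simp_all add: cnot_coeffs_def eval_nat_numeral)

definition flip_bit :: "2 \<Rightarrow> 2" where
  "flip_bit i = (if i = 1 then 2 else 1)"

text \<open>Row \<open>p\<close> of \<open>U\<close> has its only 1 in column \<open>f p\<close>, so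
  the sums in both matrix products collapse to single terms.\<close>

lemma conj_op_permutation:
  assumes "\<And>p q. U $ p $ q = (if q = f p then 1 else 0)"
  shows "conj_op U X $ p $ q = X $ f p $ f q"
  by (simp add: conj_op_def matrix_matrix_mult_def dagger_def map_matrix_def transpose_def assms
      if_distrib[of cnj] if_distrib[of "\<lambda>x. x * _"] if_distrib[of "\<lambda>x. _ * x"] cong: if_cong)

text \<open>A CNOT permutes the basis states: the target flips exactly when the control has index 2,
  the state \<open>|1>\<close>.\<close>

lemma C21_entry: "C21 $ p $ q = (if q = (if snd p = 1 then p else (flip_bit (fst p), 2)) then 1 else 0)"
  using exhaust_2[of "fst p"] exhaust_2[of "snd p"] exhaust_2[of "fst q"] exhaust_2[of "snd q"]
  by (cases p; cases q)
     (auto simp: C21_def tensor_op_def flip_bit_def mat_def sigma_x_def proj_0_def proj_1_def)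

lemma C12_entry: "C12 $ p $ q = (if q = (if fst p = 1 then p else (2, flip_bit (snd p))) then 1 else 0)"
  using exhaust_2[of "fst p"] exhaust_2[of "snd p"] exhaust_2[of "fst q"] exhaust_2[of "snd q"]
  by (cases p; cases q)
     (auto simp: C12_def tensor_op_def flip_bit_def mat_def sigma_x_def proj_0_def proj_1_def)

lemma pauli_eq:
  "pauli 0 = vector [vector [1, 0], vector [0, 1]]"
  "pauli 1 = vector [vector [0, 1], vector [1, 0]]"
  "pauli 2 = vector [vector [0, - \<i>], vector [\<i>, 0]]"
  "pauli 3 = vector [vector [1, 0], vector [0, - 1]]"
  by (simp_all add: pauli_def sigma_x_def sigma_y_def sigma_z_def vec_eq_iff mat_def forall_2)

lemma lessThan_4: "{..<4::nat} = {0, 1, 2, 3}"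
  by auto

lemma conj_op_C21: "conj_op C21 (pauli_sum2 t) = pauli_sum2 (cnot_coeffs t)"
  unfolding pauli_sum2_left pauli_sum_eq
  by (simp add: vec_eq_iff conj_op_permutation[OF C21_entry] forall_2 flip_bit_def
      tensor_op_def pauli_eq lessThan_4 cnot_coeffs_simps complex_eq_iff
      del: One_nat_def)

text \<open>\<open>C12\<close> is \<open>C21\<close> with the qubits exchanged, so the table is
  transposed before and after \<open>cnot_coeffs\<close>.\<close>

lemma conj_op_C12:
  "conj_op C12 (pauli_sum2 t) = pauli_sum2 (\<lambda>i j. cnot_coeffs (\<lambda>k l. t l k) j i)"
  unfolding pauli_sum2_left pauli_sum_eq
  by (simp add: vec_eq_iff conj_op_permutation[OF C12_entry] forall_2 flip_bit_def
      tensor_op_def pauli_eq lessThan_4 cnot_coeffs_simps complex_eq_iff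
      del: One_nat_def)

section \<open>Bloch vectors, partial traces and equatorial states\<close>

lemma bloch_xy_pauli_sum: "bloch_xy (pauli_sum v) = vector [2 * v 1, 2 * v 2]"
  by (simp add: bloch_xy_def bloch_vector_def trace_def sum_2 matrix_matrix_mult_def
     sigma_x_def sigma_y_def vec_eq_iff forall_2 pauli_sum_eq)

text \<open>\<open>sigma_x\<close>, \<open>sigma_y\<close> and \<open>sigma_z\<close> are traceless,
  so only terms with the identity on the traced-out qubit survive, with its trace 2 as
  factor.\<close>

lemma partial_traces_pauli_sum2:
  "tr_2 (pauli_sum2 t) = pauli_sum (\<lambda>i. 2 * t i 0)"
  "tr_1 (pauli_sum2 t) = pauli_sum (\<lambda>j. 2 * t 0 j)"
  unfolding pauli_sum2_left tr_1_def tr_2_def pauli_sum_eq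
  by (simp_all add: vec_eq_iff forall_2 sum_2 tensor_op_def pauli_eq lessThan_4 complex_eq_iff
      del: One_nat_def)

text \<open>Unit trace and vanishing z component make both diagonal entries 1/2; Hermiticity leaves
  one free complex off-diagonal entry.\<close>

lemma equatorial_state_pauli_sum:
  assumes "equatorial_state \<rho>"
  obtains x y where "\<rho> = pauli_sum ((\<lambda>_. 0)(0 := 1/2, 1 := x, 2 := y))"
proof -
  from assms have herm: "dagger \<rho> = \<rho>" and tr: "trace \<rho> = 1" and z: "bloch_vector \<rho> $ 3 = 0"
    by (auto simp: equatorial_state_def density_matrix_def)
  have h: "cnj (\<rho> $ j $ i) = \<rho> $ i $ j" for i j
    using arg_cong[OF herm, of "\<lambda>A. A $ i $ j"] by (simp add: dagger_def map_matrix_def transpose_def)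
  have im: "Im (\<rho> $ 1 $ 1) = 0" "Im (\<rho> $ 2 $ 2) = 0"
    and off: "Re (\<rho> $ 1 $ 2) = Re (\<rho> $ 2 $ 1)" "Im (\<rho> $ 1 $ 2) = - Im (\<rho> $ 2 $ 1)"
    using h[of 1 1] h[of 2 2] h[of 1 2] by (simp_all add: complex_eq_iff)
  have "Re (\<rho> $ 1 $ 1) + Re (\<rho> $ 2 $ 2) = 1"
    using arg_cong[OF tr, of Re] by (simp add: trace_def sum_2)
  moreover have "Re (\<rho> $ 1 $ 1) - Re (\<rho> $ 2 $ 2) = 0"
    using z by (simp add: trace_def sum_2 bloch_vector_def matrix_matrix_mult_def sigma_z_def)
  ultimately have "Re (\<rho> $ 1 $ 1) = 1 / 2" "Re (\<rho> $ 2 $ 2) = 1 / 2" by simp_all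
  \<comment> \<open>In a Pauli sum the entry in row 2, column 1 has real part \<open>v 1\<close> and
    imaginary part \<open>v 2\<close>, which yields the witnesses.\<close>
  then have "\<rho> = pauli_sum ((\<lambda>_. 0)(0 := 1/2, 1 := Re (\<rho> $ 2 $ 1), 2 := Im (\<rho> $ 2 $ 1)))"
    using im off by (simp add: pauli_sum_eq vec_eq_iff forall_2 complex_eq_iff)
  then show ?thesis using that by blast
qed

text \<open>The quotient becomes a squared norm over itself, nonzero by definedness.\<close>

lemma quantum_phase_fidelity_eq_bloch:
  assumes "bloch_xy \<rho>1 = bloch_xy \<rho>2" "quantum_phase_fidelity \<rho>1 \<rho>2 \<noteq> None"
  shows "quantum_phase_fidelity \<rho>1 \<rho>2 = Some 1"
  using assms by (auto simp: quantum_phase_fidelity_def dot_square_norm power2_eq_square split: if_splits)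

text \<open>Separates a simultaneous pair of gates into one-qubit gates, to which
  \<open>conj_op_left\<close> and \<open>conj_op_right\<close> apply.\<close>

lemma tensor_op_split: "A \<otimes>\<^sub>q B = (A \<otimes>\<^sub>q mat 1) ** (mat 1 \<otimes>\<^sub>q B)"
  by (simp add: tensor_op_mult)

section \<open>Synchronization from relations between the angles\<close>

text \<open>As \<open>sin \<mu>\<close> and \<open>cos \<nu>\<close> are signs, the last two
  hypotheses amount to \<open>cos (\<alpha> - sin \<mu> * \<gamma>) = 0\<close> and
  \<open>cos (\<beta> + cos \<nu> * sin \<mu> * \<gamma>) = 0\<close>, in a form suited to
  polynomial reasoning.\<close>

lemma perfect_sync_sync_unitary:
  assumes \<mu>: "cos \<mu> = 0" and \<nu>: "sin \<nu> = 0"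
    and \<alpha>\<gamma>: "sin \<alpha> * sin \<gamma> = - sin \<mu> * (cos \<alpha> * cos \<gamma>)"
    and \<beta>\<gamma>: "sin \<beta> * sin \<gamma> = cos \<nu> * sin \<mu> * (cos \<beta> * cos \<gamma>)"
  shows "perfect_sync_equatorial (sync_unitary \<alpha> \<beta> \<gamma> \<mu> \<nu>)"
  unfolding perfect_sync_equatorial_def
proof (intro allI impI)
  fix \<rho>1 \<rho>2
  assume eq: "equatorial_state \<rho>1" "equatorial_state \<rho>2"
    and def: "phase_sync_fidelity (\<rho>1 \<otimes>\<^sub>q \<rho>2) (sync_unitary \<alpha> \<beta> \<gamma> \<mu> \<nu>) \<noteq> None"
  obtain x1 y1 where \<rho>1: "\<rho>1 = pauli_sum ((\<lambda>_. 0)(0 := 1/2, 1 := x1, 2 := y1))"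
    using eq(1) by (rule equatorial_state_pauli_sum)
  obtain x2 y2 where \<rho>2: "\<rho>2 = pauli_sum ((\<lambda>_. 0)(0 := 1/2, 1 := x2, 2 := y2))"
    using eq(2) by (rule equatorial_state_pauli_sum)
  have sq: "sin \<mu> * sin \<mu> = 1" "cos \<nu> * cos \<nu> = 1"
    using sin_cos_squared_add[of \<mu>] sin_cos_squared_add[of \<nu>] \<mu> \<nu>
    by (simp_all add: power2_eq_square)
  \<comment> \<open>The signs square to 1, so each relation can be solved for its other
    product.\<close>
  have \<alpha>\<gamma>': "cos \<alpha> * cos \<gamma> = - sin \<mu> * (sin \<alpha> * sin \<gamma>)"
    unfolding \<alpha>\<gamma> using sq(1) by algebra
  have \<beta>\<gamma>': "cos \<beta> * cos \<gamma> = cos \<nu> * sin \<mu> * (sin \<beta> * sin \<gamma>)"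
    unfolding \<beta>\<gamma> using sq by algebra
  let ?\<rho>' = "conj_op (sync_unitary \<alpha> \<beta> \<gamma> \<mu> \<nu>) (\<rho>1 \<otimes>\<^sub>q \<rho>2)"
  have c: "conj_op (R_y \<nu> ** R_z \<mu>) (pauli_sum v) = pauli_sum (rot_y \<nu> (rot_z \<mu> v))" for v
    by (simp add: conj_op_mult conj_op_R_y conj_op_R_z)
  \<comment> \<open>The final x components are combinations of \<open>x1\<close> and
    \<open>y2\<close> and agree by \<open>\<beta>\<gamma>\<close>; the final y components are
    combinations of \<open>x2\<close> and \<open>y1\<close> and agree by
    \<open>\<alpha>\<gamma>\<close>.\<close>
  have "bloch_xy (tr_2 ?\<rho>') = bloch_xy (tr_1 ?\<rho>')"
    unfolding sync_unitary_def tensor_op_split[of "R_z _" "R_y _"] \<rho>1 \<rho>2 conj_op_mult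
      pauli_sum2_product conj_op_C12 conj_op_C21 conj_op_left[OF c] conj_op_left[OF conj_op_R_z]
      conj_op_right[OF conj_op_R_y] partial_traces_pauli_sum2 bloch_xy_pauli_sum
      rot_y_simps rot_z_simps cnot_coeffs_simps
    using \<alpha>\<gamma> \<alpha>\<gamma>' \<beta>\<gamma> \<beta>\<gamma>' by (simp add: \<mu> \<nu> vec_eq_iff forall_2, algebra)
  then show "phase_sync_fidelity (\<rho>1 \<otimes>\<^sub>q \<rho>2) (sync_unitary \<alpha> \<beta> \<gamma> \<mu> \<nu>) = Some 1"
    using def quantum_phase_fidelity_eq_bloch
    by (simp add: phase_sync_fidelity_def conj_op_def Let_def)
qed

section \<open>Trigonometry of the admissible angles\<close>

text \<open>This and nonnegativity replace a case split over all 64 angle triples.\<close>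

lemma cos_double_odd_quarter_pi:
  assumes "x \<in> {pi / 4, 3 * pi / 4, 5 * pi / 4, 7 * pi / 4}"
  shows "cos (2 * x) = 0"
proof -
  obtain n :: nat where "odd n" "x = real n * (pi / 4)"
  proof -
    from assms consider "x = real 1 * (pi / 4)" | "x = real 3 * (pi / 4)"
      | "x = real 5 * (pi / 4)" | "x = real 7 * (pi / 4)"
      by auto
    then show ?thesis
      using that by cases simp_all
  qed
  then have "odd n \<and> 2 * x = real n * (pi / 2)" by simp
  then show ?thesis
    unfolding cos_zero_iff by blast
qed

text \<open>Zeros of the sine are integer multiples of pi; \<open>0 \<le> x\<close> makes the
  multiplier a natural number.\<close>

lemma nonneg_multiple_pi_iff:
  assumes "0 \<le> x"
  shows "x \<in> {real k * pi | k. True} \<longleftrightarrow> sin x = 0"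
proof
  assume "sin x = 0"
  then obtain i :: int where i: "x = of_int i * pi"
    by (auto simp: sin_zero_iff_int2)
  with assms have "0 \<le> i"
    using pi_gt_zero by (simp only: zero_le_mult_iff) linarith
  with i have "x = real (nat i) * pi" by simp
  then show "x \<in> {real k * pi | k. True}" by blast
qed auto

text \<open>Here \<open>sin (2 * (x + y)) = 0\<close>, so the sine or the cosine of
  \<open>x + y\<close> vanishes, and this decides which one vanishes at
  \<open>x - y\<close>.\<close>

lemma sin_add_zero_cases:
  fixes x y :: real
  assumes "cos (2 * x) = 0" "cos (2 * y) = 0"
  obtains "sin (x + y) = 0" "cos (x - y) = 0"
    | "sin (x + y) \<noteq> 0" "cos (x + y) = 0" "sin (x - y) = 0"
proof -
  have "2 * sin (x + y) * cos (x + y) = 0"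
    using sin_double[of "x + y"] sin_add[of "2 * x" "2 * y"] assms by (simp add: distrib_left)
  \<comment> \<open>Writing \<open>x - y\<close> as \<open>(x + y) - 2 * y\<close>, only the term
    with \<open>sin (2 * y)\<close> remains.\<close>
  moreover have "cos (x - y) = sin (x + y) * sin (2 * y)"
    using cos_diff[of "x + y" "2 * y"] assms by simp
  moreover have "sin (x - y) = - cos (x + y) * sin (2 * y)"
    using sin_diff[of "x + y" "2 * y"] assms by simp
  ultimately show ?thesis
    using that by auto
qed

section \<open>The admissible angles satisfy the relations\<close>

lemma perfect_sync_odd_quarter_pi:
  fixes \<alpha> \<beta> \<gamma> \<mu> \<nu> :: real
  assumes \<alpha>: "\<alpha> \<in> {pi / 4, 3 * pi / 4, 5 * pi / 4, 7 * pi / 4}"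
    and \<beta>: "\<beta> \<in> {pi / 4, 3 * pi / 4, 5 * pi / 4, 7 * pi / 4}"
    and \<gamma>: "\<gamma> \<in> {pi / 4, 3 * pi / 4, 5 * pi / 4, 7 * pi / 4}"
    and \<mu>: "\<mu> = (if \<alpha> + \<gamma> \<in> {real k * pi | k. True} then pi / 2 else 3 * pi / 2)"
    and \<nu>: "\<nu> = (if \<alpha> + \<beta> \<in> {real k * pi | k. True} then 0 else pi)"
  shows "perfect_sync_equatorial (sync_unitary \<alpha> \<beta> \<gamma> \<mu> \<nu>)"
proof -
  have cos2: "cos (2 * \<alpha>) = 0" "cos (2 * \<beta>) = 0" "cos (2 * \<gamma>) = 0"
    using \<alpha> \<beta> \<gamma> by (simp_all only: cos_double_odd_quarter_pi)
  have nonneg: "0 \<le> x" if "x \<in> {pi / 4, 3 * pi / 4, 5 * pi / 4, 7 * pi / 4}" for x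
    using that pi_gt_zero by (elim insertE emptyE) linarith+
  have \<mu>': "\<mu> = (if sin (\<alpha> + \<gamma>) = 0 then pi / 2 else 3 * pi / 2)"
    using \<alpha>[THEN nonneg] \<gamma>[THEN nonneg] by (simp only: \<mu> nonneg_multiple_pi_iff add_nonneg_nonneg)
  have \<nu>': "\<nu> = (if sin (\<alpha> + \<beta>) = 0 then 0 else pi)"
    using \<alpha>[THEN nonneg] \<beta>[THEN nonneg] by (simp only: \<nu> nonneg_multiple_pi_iff add_nonneg_nonneg)
  have s3: "sin (3 * pi / 2) = -1" "cos (3 * pi / 2) = 0"
    using sin_3over2_pi cos_3over2_pi by simp_all
  have cos_\<mu>: "cos \<mu> = 0" and sin_\<nu>: "sin \<nu> = 0"
    unfolding \<mu> \<nu> using s3 by simp_all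
  \<comment> \<open>Either \<open>sin \<mu> = 1\<close> and
    \<open>cos (\<alpha> - \<gamma>) = 0\<close>, or \<open>sin \<mu> = - 1\<close> and
    \<open>cos (\<alpha> + \<gamma>) = 0\<close>; both expand to the claim.\<close>
  have \<alpha>\<gamma>: "sin \<alpha> * sin \<gamma> = - sin \<mu> * (cos \<alpha> * cos \<gamma>)"
    by (rule sin_add_zero_cases[OF cos2(1,3)])
       (simp_all add: \<mu>' s3 cos_add cos_diff)
  have \<alpha>\<beta>: "sin \<alpha> * cos \<beta> = - cos \<nu> * (cos \<alpha> * sin \<beta>)"
    by (rule sin_add_zero_cases[OF cos2(1,2)])
       (simp_all add: \<nu>' sin_add sin_diff)
  have "cos \<alpha> \<noteq> 0"
    using cos2(1) by (auto simp: cos_double_cos)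
  moreover have "cos \<nu> * cos \<nu> = 1"
    using sin_cos_squared_add[of \<nu>] sin_\<nu> by (simp add: power2_eq_square)
  \<comment> \<open>The factor \<open>cos \<alpha>\<close> lets \<open>\<alpha>\<beta>\<close> trade
    \<open>cos \<alpha> * sin \<beta>\<close> for a multiple of
    \<open>sin \<alpha> * cos \<beta>\<close>, after which \<open>\<alpha>\<gamma>\<close> applies;
    it is cancelled next.\<close>
  then have "cos \<alpha> * (sin \<beta> * sin \<gamma>) = cos \<alpha> * (cos \<nu> * sin \<mu> * (cos \<beta> * cos \<gamma>))"
    using \<alpha>\<gamma> \<alpha>\<beta> by algebra
  ultimately have "sin \<beta> * sin \<gamma> = cos \<nu> * sin \<mu> * (cos \<beta> * cos \<gamma>)"
    by simp
  with cos_\<mu> sin_\<nu> \<alpha>\<gamma> show ?thesis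
    by (rule perfect_sync_sync_unitary)
qed

theorem mainTheorem5:
  fixes \<alpha> \<beta> \<gamma> \<mu>\<^sub>1 \<nu>\<^sub>1 :: real
  assumes "\<alpha> \<in> {pi / 4, 3 * pi / 4, 5 * pi / 4, 7 * pi / 4}"
    and "\<beta> \<in> {pi / 4, 3 * pi / 4, 5 * pi / 4, 7 * pi / 4}"
    and "\<gamma> \<in> {pi / 4, 3 * pi / 4, 5 * pi / 4, 7 * pi / 4}"
    and "\<mu>\<^sub>1 = (if \<alpha> + \<gamma> \<in> {real k * pi | k. True} then pi / 2 else 3 * pi / 2)"
    and "\<nu>\<^sub>1 = (if \<alpha> + \<beta> \<in> {real k * pi | k. True} then 0 else pi)"
  shows "perfect_sync_equatorial (sync_unitary \<alpha> \<beta> \<gamma> \<mu>\<^sub>1 \<nu>\<^sub>1) \<and> perfect_sync_equatorial U_max"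
proof
  show "perfect_sync_equatorial (sync_unitary \<alpha> \<beta> \<gamma> \<mu>\<^sub>1 \<nu>\<^sub>1)"
    using assms by (rule perfect_sync_odd_quarter_pi)
  \<comment> \<open>For \<open>U_max\<close> both \<alpha> + \<gamma> and \<alpha> + \<beta> equal
    pi, so \<open>k = 1\<close> selects the first branch for both outer angles.\<close>
  have "3 * pi / 4 + pi / 4 = real 1 * pi" by simp
  then have "3 * pi / 4 + pi / 4 \<in> {real k * pi | k. True}" by blast
  then show "perfect_sync_equatorial U_max"
    unfolding U_max_def by (intro perfect_sync_odd_quarter_pi) simp_all
qed

end
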